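(* There exists a game $m$ over a set $N$ of players with $|N|=6$ such that both $m$ and its anti-dual $m^{\diamond}$ are totally balanced, while $m$ is not exact.
   Context: A game over a finite set $N$ is a function $m:\mathcal{P}(N)\to\mathbb{R}$ with $m(\emptyset)=0$, where $\mathcal{P}(N)$ is the power set of $N$. The core of $m$ is $C(m)=\{x\in\mathbb{R}^N:\sum_{i\in N}x_i=m(N),\ \sum_{i\in S}x_i\geq m(S)\ \forall S\subseteq N\}$. The game $m$ is balanced if $C(m)\neq\emptyset$. It is totally balanced if for every $\emptyset\neq S\subseteq N$ the subgame $m_S$ (the restriction of $m$ to $\mathcal{P}(S)$, viewed as a game over $S$) is balanced. It is exact if for each $S\subseteq N$ there exists $x\in C(m)$ with $\sum_{i\in S}x_i=m(S)$. The anti-dual of $m$ is the game $m^{\diamond}(S):=m(N\setminus S)-m(N)$ for $S\subseteq N$. *)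

theory Defs
  imports Complex_Main "HOL-Library.FuncSet"
begin

text \<open>
  A function with domain \<open>D\<close> is rendered as a HOL function in \<open>extensional D\<close>,
  i.e. one that is \<open>undefined\<close> outside \<open>D\<close>.  So games over \<open>N\<close> are functions on \<open>Pow N\<close>,
  and the elements of \<open>extensional N :: ('a \<Rightarrow> real) set\<close> are exactly the vectors
  of $\mathbb{R}^N$.
\<close>

definition game :: "'a set \<Rightarrow> ('a set \<Rightarrow> real) \<Rightarrow> bool" where
  "game N m \<longleftrightarrow> finite N \<and> m \<in> extensional (Pow N) \<and> m {} = 0"

definition core :: "'a set \<Rightarrow> ('a set \<Rightarrow> real) \<Rightarrow> ('a \<Rightarrow> real) set" where
  "core N m = {x \<in> extensional N.
     (\<Sum>i\<in>N. x i) = m N \<and> (\<forall>S\<subseteq>N. (\<Sum>i\<in>S. x i) \<ge> m S)}"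

definition balanced :: "'a set \<Rightarrow> ('a set \<Rightarrow> real) \<Rightarrow> bool" where
  "balanced N m \<longleftrightarrow> core N m \<noteq> {}"

definition subgame :: "('a set \<Rightarrow> real) \<Rightarrow> 'a set \<Rightarrow> ('a set \<Rightarrow> real)" where
  "subgame m S = restrict m (Pow S)"

definition totally_balanced :: "'a set \<Rightarrow> ('a set \<Rightarrow> real) \<Rightarrow> bool" where
  "totally_balanced N m \<longleftrightarrow> (\<forall>S\<subseteq>N. S \<noteq> {} \<longrightarrow> balanced S (subgame m S))"

definition exact :: "'a set \<Rightarrow> ('a set \<Rightarrow> real) \<Rightarrow> bool" where
  "exact N m \<longleftrightarrow> (\<forall>S\<subseteq>N. \<exists>x\<in>core N m. (\<Sum>i\<in>S. x i) = m S)"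

definition anti_dual :: "'a set \<Rightarrow> ('a set \<Rightarrow> real) \<Rightarrow> ('a set \<Rightarrow> real)" where
  "anti_dual N m = (\<lambda>S\<in>Pow N. m (N - S) - m N)"

lemma game_subgame: "game N m \<Longrightarrow> S \<subseteq> N \<Longrightarrow> game S (subgame m S)"
  by (auto simp: game_def subgame_def intro: finite_subset)

lemma game_anti_dual: "game N m \<Longrightarrow> game N (anti_dual N m)"
  by (auto simp: game_def anti_dual_def)

end

theory Submission
  imports Defs
begin

text \<open>
  A pointwise minimum of additive games is totally balanced: on the players of \<open>S\<close>, an additive
  game attaining the minimum at \<open>S\<close> is a core element of the subgame.  The counterexample is a
  minimum of seven additive games whose anti-dual is again a minimum of seven additive games.

  It lives on the edges of $K_4$, with the edges \<open>0, 1, 2\<close> forming a triangle and \<open>5, 4, 3\<close> being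
  opposite to them, and is invariant under the automorphisms of $K_4$: stars have value 2 and
  triangles value 1.  The triangle \<open>{0, 1, 2}\<close> violates exactness, because the three stars
  \<open>{0, 1, 3}\<close>, \<open>{0, 2, 4}\<close>, \<open>{1, 2, 5}\<close> together cover the whole edge set once and this triangle
  once more, while \<open>2 + 2 + 2 > 4 + 1\<close>.
\<close>

lemma totally_balanced_MIN_additive:
  fixes a :: "'j \<Rightarrow> 'a \<Rightarrow> real"
  assumes "finite J" "J \<noteq> {}"
    and m: "\<And>S. S \<subseteq> N \<Longrightarrow> m S = (MIN j\<in>J. \<Sum>i\<in>S. a j i)"
  shows "totally_balanced N m"
  unfolding totally_balanced_def balanced_def
proof (intro allI impI)
  fix S assume S: "S \<subseteq> N"
  have "(MIN j\<in>J. \<Sum>i\<in>S. a j i) \<in> (\<lambda>j. \<Sum>i\<in>S. a j i) ` J"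
    using assms(1,2) by (intro Min_in) auto
  then obtain j where j: "j \<in> J" "m S = (\<Sum>i\<in>S. a j i)"
    using m[OF S] by auto
  have le: "m T \<le> (\<Sum>i\<in>T. a j i)" if "T \<subseteq> S" for T
    using m[of T] that S j(1) assms(1) by (auto intro!: Min_le)
  have "restrict (a j) S \<in> core S (subgame m S)"
    unfolding core_def
  proof (safe intro!: restrict_extensional)
    show "(\<Sum>i\<in>S. restrict (a j) S i) = subgame m S S"
      using j(2) by (simp add: subgame_def)
  next
    fix T assume T: "T \<subseteq> S"
    have "(\<Sum>i\<in>T. restrict (a j) S i) = (\<Sum>i\<in>T. a j i)"
      using T by (intro sum.cong) auto
    then show "(\<Sum>i\<in>T. restrict (a j) S i) \<ge> subgame m S T"
      using le[OF T] T by (simp add: subgame_def)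
  qed
  then show "core S (subgame m S) \<noteq> {}" by auto
qed

text \<open>The first three rows are the perfect matchings with weight 2 and have total 4. Each
  later row has total 5 and takes value 1 on one triangle, 3 on the other three.\<close>

definition upper_vectors :: "real list set" where
  "upper_vectors =
     {[2,0,0,0,0,2], [0,2,0,0,2,0], [0,0,2,2,0,0],
      [0,2,1,0,1,1], [1,1,1,2,0,0], [0,0,1,2,1,1], [2,0,1,0,1,1]}"

text \<open>The perfect matchings (with weight 2) and the stars of $K_4$, negated.\<close>

definition anti_dual_vectors :: "real list set" where
  "anti_dual_vectors =
     {[-2,0,0,0,0,-2], [0,-2,0,0,-2,0], [0,0,-2,-2,0,0],
      [-1,-1,0,-1,0,0], [-1,0,-1,0,-1,0], [0,-1,-1,0,0,-1], [0,0,0,-1,-1,-1]}"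

lemma finite_upper_vectors: "finite upper_vectors"
  and upper_vectors_nonempty: "upper_vectors \<noteq> {}"
  by (simp_all add: upper_vectors_def)

lemma finite_anti_dual_vectors: "finite anti_dual_vectors"
  and anti_dual_vectors_nonempty: "anti_dual_vectors \<noteq> {}"
  by (simp_all add: anti_dual_vectors_def)

definition k4_game :: "nat set \<Rightarrow> real" where
  "k4_game = (\<lambda>S\<in>Pow {..<6}. MIN v\<in>upper_vectors. \<Sum>i\<in>S. v ! i)"

text \<open>Makes a coalition sum depend on six membership bits only, so that game values become
  finite computations.\<close>

lemma sum_subset_lessThan_6:
  fixes f :: "nat \<Rightarrow> real"
  assumes "S \<subseteq> {..<6}"
  shows "(\<Sum>i\<in>S. f i) = of_bool (0 \<in> S) * f 0 + of_bool (1 \<in> S) * f 1 + of_bool (2 \<in> S) * f 2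
    + of_bool (3 \<in> S) * f 3 + of_bool (4 \<in> S) * f 4 + of_bool (5 \<in> S) * f 5"
proof -
  have "(\<Sum>i\<in>S. f i) = (\<Sum>i<6. of_bool (i \<in> S) * f i)"
    using assms by (intro sum.mono_neutral_cong_left) auto
  then show ?thesis
    by (simp add: eval_nat_numeral)
qed

lemma k4_game_values:
  "k4_game {} = 0" "k4_game {..<6} = 4" "k4_game {0,1,2} = 1"
  "k4_game {0,1,3} = 2" "k4_game {0,2,4} = 2" "k4_game {1,2,5} = 2"
  by (simp_all add: k4_game_def sum_subset_lessThan_6, simp_all add: upper_vectors_def)

lemma totally_balanced_k4_game: "totally_balanced {..<6} k4_game"
  by (rule totally_balanced_MIN_additive[of upper_vectors _ _ "(!)"])
    (simp_all add: finite_upper_vectors upper_vectors_nonempty k4_game_def)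

text \<open>The rows do not correspond one by one: a row \<open>v\<close> of total 5 yields
  \<open>1 - v(S)\<close>, which is not additive. Only the minima agree, hence the check of all 64
  coalitions.\<close>

lemma anti_dual_k4_game:
  assumes "S \<subseteq> {..<6}"
  shows "anti_dual {..<6} k4_game S = (MIN v\<in>anti_dual_vectors. \<Sum>i\<in>S. v ! i)"
proof -
  have compl: "{..<6} - S \<subseteq> {..<6}" by blast
  have mem_compl: "i \<in> {..<6} - S \<longleftrightarrow> i < 6 \<and> i \<notin> S" for i by auto
  have "(MIN v\<in>upper_vectors. \<Sum>i\<in>{..<6} - S. v ! i) - 4 = (MIN v\<in>anti_dual_vectors. \<Sum>i\<in>S. v ! i)"
    unfolding sum_subset_lessThan_6[OF assms] sum_subset_lessThan_6[OF compl] mem_compl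
      upper_vectors_def anti_dual_vectors_def
    by (cases "0 \<in> S"; cases "1 \<in> S"; cases "2 \<in> S"; cases "3 \<in> S"; cases "4 \<in> S"; cases "5 \<in> S";
        simp only: of_bool_eq mult_1 mult_zero_left add_0_left add_0_right simp_thms; simp)
  then show ?thesis
    using assms compl by (simp add: anti_dual_def k4_game_values(2)) (simp add: k4_game_def)
qed

lemma totally_balanced_anti_dual_k4_game: "totally_balanced {..<6} (anti_dual {..<6} k4_game)"
  by (rule totally_balanced_MIN_additive[of anti_dual_vectors _ _ "(!)"])
    (simp_all add: finite_anti_dual_vectors anti_dual_vectors_nonempty anti_dual_k4_game)

lemma not_exact_k4_game: "\<not> exact {..<6} k4_game"
proof
  assume "exact {..<6} k4_game"
  moreover have "{0,1,2} \<subseteq> {..<6::nat}" by auto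
  ultimately obtain x where x: "x \<in> core {..<6} k4_game" "(\<Sum>i\<in>{0,1,2}. x i) = 1"
    unfolding exact_def k4_game_values(3)[symmetric] by blast
  have le: "k4_game S \<le> (\<Sum>i\<in>S. x i)" if "S \<subseteq> {..<6}" for S
    using x(1) that by (auto simp: core_def)
  have "(\<Sum>i<6. x i) = 4"
    using x(1) k4_game_values(2) by (simp add: core_def)
  then have "x 0 + x 1 + x 2 + x 3 + x 4 + x 5 = 4"
    by (simp add: sum_subset_lessThan_6)
  moreover have "x 0 + x 1 + x 2 = 1"
    using x(2) by simp
  moreover have "2 \<le> x 0 + x 1 + x 3" "2 \<le> x 0 + x 2 + x 4" "2 \<le> x 1 + x 2 + x 5"
    using le[of "{0,1,3}"] le[of "{0,2,4}"] le[of "{1,2,5}"]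
    unfolding k4_game_values by (simp_all add: add.assoc)
  ultimately show False by linarith
qed

theorem mainTheorem2:
  "\<exists>(N :: nat set) m. card N = 6 \<and> game N m \<and>
     totally_balanced N m \<and> totally_balanced N (anti_dual N m) \<and> \<not> exact N m"
proof (intro exI conjI)
  show "game {..<6} k4_game"
    unfolding game_def using k4_game_values(1) by (auto simp: k4_game_def)
qed (use totally_balanced_k4_game totally_balanced_anti_dual_k4_game not_exact_k4_game in simp_all)

end
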